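(* Let $\gamma:\Gamma\to(0,\infty)$ satisfy properties (a), (b), (c) listed in the context, and suppose that $\Gamma=\{\lambda\in\mathbb{R}^n:\gamma(\lambda)>0\}$. Then there is no closed (i.e. compact without boundary) immersed $\gamma$-translator in $\mathbb{R}^{n+1}$ whose principal curvature vector $\lambda=(\lambda_1,\ldots,\lambda_n)$ belongs to $\Gamma$ at every point.
   Context: Properties of $\gamma$: (a) $\gamma:\Gamma\to(0,\infty)$ is a smooth symmetric function (invariant under all permutations of its $n$ arguments) defined on a symmetric open cone $\Gamma\subset\mathbb{R}^n$ with $\Gamma_+:=\{\lambda\in\mathbb{R}^n:\lambda_i>0\ \forall i\}\subset\Gamma$. (b) $\gamma$ is $\alpha$-homogeneous for some $\alpha>0$: $\gamma(c\lambda)=c^{\alpha}\gamma(\lambda)$ for all $\lambda\in\Gamma$, $c>0$. (c) $\frac{\partial\gamma}{\partial\lambda_i}(\lambda)>0$ for every $\lambda\in\Gamma$ and $i=1,\ldots,n$. A $\gamma$-translator in $\mathbb{R}^{n+1}$ is an immersed hypersurface with unit normal field $\nu$ and principal curvature vector $\lambda=(\lambda_1,\ldots,\lambda_n)$ (with respect to $\nu$) satisfying $\gamma(\lambda)=\langle\nu,e_{n+1}\rangle$ at every point, where $e_{n+1}$ is the last standard basis vector (the direction of translation is normalized to be $e_{n+1}$). The principal curvatures are the eigenvalues of the Weingarten map $h^i_j=g^{ik}h_{kj}$, where $h_{ij}=-\langle\nabla_i\nu,e_j\rangle$ for a local tangent frame $\{e_i\}$, so that round spheres have positive principal curvatures with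 respect to the inward normal. *)

theory Defs
  imports "HOL-Analysis.Analysis"
begin

text \<open>These notions are only applied to open sets \<open>S\<close>. In finite dimension, \<open>f\<close> is \<open>C\<^sup>k\<^sup>+\<^sup>1\<close> on
  an open set iff it is differentiable there and all its directional derivatives are \<open>C\<^sup>k\<close>.\<close>

primrec Ck_on :: "nat \<Rightarrow> 'a::real_normed_vector set \<Rightarrow> ('a \<Rightarrow> 'b::real_normed_vector) \<Rightarrow> bool" where
  "Ck_on 0 S f \<longleftrightarrow> continuous_on S f"
| "Ck_on (Suc k) S f \<longleftrightarrow>
     (\<forall>x\<in>S. f differentiable (at x)) \<and> (\<forall>v. Ck_on k S (\<lambda>x. frechet_derivative f (at x) v))"

definition smooth_on :: "'a::real_normed_vector set \<Rightarrow> ('a \<Rightarrow> 'b::real_normed_vector) \<Rightarrow> bool" where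
  "smooth_on S f \<longleftrightarrow> (\<forall>k. Ck_on k S f)"

definition partial_deriv ::
    "(real^'n \<Rightarrow> 'b::real_normed_vector) \<Rightarrow> 'n \<Rightarrow> real^'n \<Rightarrow> 'b" where
  "partial_deriv f i x = frechet_derivative f (at x) (axis i 1)"

text \<open>The library's \<^const>\<open>cone\<close> and \<^const>\<open>conic\<close> allow the factor \<open>0\<close> and so would force
  \<open>0 \<in> \<Gamma>\<close>; an open cone is only closed under positive dilations.\<close>

definition symmetric_open_cone :: "(real^'n) set \<Rightarrow> bool" where
  "symmetric_open_cone \<Gamma> \<longleftrightarrow>
     open \<Gamma> \<and>
     (\<forall>l\<in>\<Gamma>. \<forall>c>0. c *\<^sub>R l \<in> \<Gamma>) \<and>
     (\<forall>l\<in>\<Gamma>. \<forall>\<pi>. bij \<pi> \<longrightarrow> (\<chi> i. l $ \<pi> i) \<in> \<Gamma>)"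

definition positive_cone :: "(real^'n) set" where
  "positive_cone = {l. \<forall>i. l $ i > 0}"

text \<open>The function \<open>\<gamma> : \<Gamma> \<rightarrow> (0, \<infinity>)\<close> is represented by a total function; only its values on \<open>\<Gamma>\<close>
  are constrained here.\<close>

definition curvature_function :: "(real^'n) set \<Rightarrow> (real^'n \<Rightarrow> real) \<Rightarrow> bool" where
  "curvature_function \<Gamma> \<gamma> \<longleftrightarrow>
     symmetric_open_cone \<Gamma> \<and> positive_cone \<subseteq> \<Gamma> \<and>
     (\<forall>l\<in>\<Gamma>. \<gamma> l > 0) \<and>
     smooth_on \<Gamma> \<gamma> \<and>
     (\<forall>l\<in>\<Gamma>. \<forall>\<pi>. bij \<pi> \<longrightarrow> \<gamma> (\<chi> i. l $ \<pi> i) = \<gamma> l) \<and>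
     (\<exists>\<alpha>>0. \<forall>l\<in>\<Gamma>. \<forall>c>0. \<gamma> (c *\<^sub>R l) = c powr \<alpha> * \<gamma> l) \<and>
     (\<forall>l\<in>\<Gamma>. \<forall>i. partial_deriv \<gamma> i l > 0)"

type_synonym ('a, 'n) chart = "'a set \<times> ('a \<Rightarrow> real^'n)"

definition is_chart :: "'a topology \<Rightarrow> ('a, 'n::finite) chart \<Rightarrow> bool" where
  "is_chart M = (\<lambda>(U, \<phi>).
     openin M U \<and> open (\<phi> ` U) \<and>
     homeomorphic_map (subtopology M U) (top_of_set (\<phi> ` U)) \<phi>)"

definition smooth_atlas :: "'a topology \<Rightarrow> ('a, 'n::finite) chart set \<Rightarrow> bool" where
  "smooth_atlas M A \<longleftrightarrow>
     (\<forall>c\<in>A. is_chart M c) \<and>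
     topspace M = (\<Union>(U, \<phi>)\<in>A. U) \<and>
     (\<forall>(U, \<phi>)\<in>A. \<forall>(V, \<psi>)\<in>A. smooth_on (\<phi> ` (U \<inter> V)) (\<psi> \<circ> inv_into U \<phi>))"

text \<open>All charts map onto open subsets of \<open>\<real>\<^sup>n\<close>, so the manifold has no boundary.\<close>

definition closed_manifold :: "'a topology \<Rightarrow> ('a, 'n::finite) chart set \<Rightarrow> bool" where
  "closed_manifold M A \<longleftrightarrow>
     topspace M \<noteq> {} \<and> Hausdorff_space M \<and> second_countable M \<and> compact_space M \<and>
     smooth_atlas M A"

definition smooth_map ::
    "('a, 'n::finite) chart set \<Rightarrow> ('a \<Rightarrow> 'b::real_normed_vector) \<Rightarrow> bool" where
  "smooth_map A F \<longleftrightarrow> (\<forall>(U, \<phi>)\<in>A. smooth_on (\<phi> ` U) (F \<circ> inv_into U \<phi>))"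

text \<open>\<open>\<real>\<^sup>n\<^sup>+\<^sup>1\<close> is \<open>\<real>\<^sup>n \<times> \<real>\<close> with the Euclidean product inner product, the last coordinate being the
  second component.\<close>

type_synonym 'n ambient = "(real^'n) \<times> real"

definition e_last :: "'n::finite ambient" where
  "e_last = (0, 1)"

definition immersion :: "('a, 'n::finite) chart set \<Rightarrow> ('a \<Rightarrow> 'n ambient) \<Rightarrow> bool" where
  "immersion A F \<longleftrightarrow>
     smooth_map A F \<and>
     (\<forall>(U, \<phi>)\<in>A. \<forall>x\<in>\<phi> ` U. inj (frechet_derivative (F \<circ> inv_into U \<phi>) (at x)))"

definition unit_normal_field ::
    "('a, 'n::finite) chart set \<Rightarrow> ('a \<Rightarrow> 'n ambient) \<Rightarrow> ('a \<Rightarrow> 'n ambient) \<Rightarrow> bool" where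
  "unit_normal_field A F \<nu> \<longleftrightarrow>
     smooth_map A \<nu> \<and>
     (\<forall>(U, \<phi>)\<in>A. \<forall>p\<in>U. norm (\<nu> p) = 1 \<and>
        (\<forall>i. \<nu> p \<bullet> partial_deriv (F \<circ> inv_into U \<phi>) i (\<phi> p) = 0))"

text \<open>In the next three definitions \<open>f\<close> is a local parametrization, \<open>N\<close> the unit normal in the same
  coordinates, and the tangent frame is the coordinate frame \<open>e\<^sub>i = \<partial>\<^sub>i f\<close>.\<close>

definition first_fundamental :: "(real^'n \<Rightarrow> 'n::finite ambient) \<Rightarrow> real^'n \<Rightarrow> real^'n^'n" where
  "first_fundamental f x = (\<chi> i j. partial_deriv f i x \<bullet> partial_deriv f j x)"

definition second_fundamental ::
    "(real^'n \<Rightarrow> 'n::finite ambient) \<Rightarrow> (real^'n \<Rightarrow> 'n ambient) \<Rightarrow> real^'n \<Rightarrow> real^'n^'n" where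
  "second_fundamental f N x = (\<chi> i j. - (partial_deriv N i x \<bullet> partial_deriv f j x))"

definition weingarten ::
    "(real^'n \<Rightarrow> 'n::finite ambient) \<Rightarrow> (real^'n \<Rightarrow> 'n ambient) \<Rightarrow> real^'n \<Rightarrow> real^'n^'n" where
  "weingarten f N x = matrix_inv (first_fundamental f x) ** second_fundamental f N x"

text \<open>\<open>l\<close> lists the eigenvalues of \<open>W\<close>, in any order, each repeated according to the dimension of its
  eigenspace. For Weingarten maps, which are self-adjoint with respect to the first fundamental form,
  this agrees with the algebraic multiplicity, and such an \<open>l\<close> exists.\<close>

definition eigenvalue_vector :: "real^'n^'n \<Rightarrow> real^'n::finite \<Rightarrow> bool" where
  "eigenvalue_vector W l \<longleftrightarrow> (\<forall>t. card {i. l $ i = t} = dim {v. W *v v = t *\<^sub>R v})"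

text \<open>The matrices of the Weingarten map at \<open>p\<close> in two charts around \<open>p\<close> are similar, so the condition
  does not depend on the chart.\<close>

definition principal_curvatures ::
    "('a, 'n::finite) chart set \<Rightarrow> ('a \<Rightarrow> 'n ambient) \<Rightarrow> ('a \<Rightarrow> 'n ambient) \<Rightarrow> 'a \<Rightarrow> real^'n \<Rightarrow> bool"
  where
  "principal_curvatures A F \<nu> p l \<longleftrightarrow>
     (\<exists>(U, \<phi>)\<in>A. p \<in> U \<and>
        eigenvalue_vector (weingarten (F \<circ> inv_into U \<phi>) (\<nu> \<circ> inv_into U \<phi>) (\<phi> p)) l)"

text \<open>The immersed hypersurface \<open>F\<close> of the manifold \<open>M\<close> with atlas \<open>A\<close>, unit normal field \<open>\<nu>\<close> and
  principal curvature vector \<open>l p\<close> at each point \<open>p\<close> is a translator of velocity \<^const>\<open>e_last\<close>.\<close>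

definition translator ::
    "(real^'n \<Rightarrow> real) \<Rightarrow> 'a topology \<Rightarrow> ('a, 'n::finite) chart set \<Rightarrow> ('a \<Rightarrow> 'n ambient) \<Rightarrow>
     ('a \<Rightarrow> 'n ambient) \<Rightarrow> ('a \<Rightarrow> real^'n) \<Rightarrow> bool" where
  "translator \<gamma> M A F \<nu> l \<longleftrightarrow>
     immersion A F \<and> unit_normal_field A F \<nu> \<and>
     (\<forall>p\<in>topspace M. principal_curvatures A F \<nu> p (l p) \<and> \<gamma> (l p) = \<nu> p \<bullet> e_last)"

end

theory Submission
  imports Defs
begin

text \<open>A translator with \<open>\<lambda> \<in> \<Gamma>\<close> satisfies \<open>\<langle>\<nu>, e\<^sub>n\<^sub>+\<^sub>1\<rangle> = \<gamma>(\<lambda>) > 0\<close> everywhere, so its tangent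
  spaces are nowhere vertical: each of them projects isomorphically onto the horizontal space
  \<open>\<real>\<^sup>n\<close>. No closed immersed hypersurface has this property. By compactness some horizontal coordinate
  function of the immersion attains its maximum, and there its differential vanishes; hence the
  tangent space at that point lies in a vertical hyperplane and does not project onto \<open>\<real>\<^sup>n\<close>. So the
  vertical component of every unit normal field of a closed hypersurface vanishes somewhere
  (lemma \<open>unit_normal_horizontal_somewhere\<close>).\<close>

lemma smooth_on_imp_differentiable:
  assumes "smooth_on S f" "x \<in> S"
  shows "f differentiable (at x)"
  using assms unfolding smooth_on_def by (metis Ck_on.simps(2))

lemma smooth_on_imp_continuous_on:
  assumes "smooth_on S f"
  shows "continuous_on S f"
  using assms unfolding smooth_on_def by (metis Ck_on.simps(1))

lemma is_chartD:
  assumes "is_chart M (U, \<phi>)"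
  shows "openin M U" "open (\<phi> ` U)" "inj_on \<phi> U"
    and "continuous_map (subtopology M U) (top_of_set (\<phi> ` U)) \<phi>"
proof -
  have hom: "homeomorphic_map (subtopology M U) (top_of_set (\<phi> ` U)) \<phi>"
    and U: "openin M U" and "open (\<phi> ` U)"
    using assms by (auto simp: is_chart_def)
  then show "openin M U" "open (\<phi> ` U)"
    and "continuous_map (subtopology M U) (top_of_set (\<phi> ` U)) \<phi>"
    by (auto intro: homeomorphic_imp_continuous_map)
  show "inj_on \<phi> U"
    using homeomorphic_imp_injective_map[OF hom] openin_subset[OF U] by (simp add: Int_absorb1)
qed

lemma smooth_map_imp_continuous_map:
  assumes atlas: "smooth_atlas M A" and F: "smooth_map A F"
  shows "continuous_map M euclidean F"
proof (rule pasting_lemma[where I = A and T = fst and f = "\<lambda>_. F"])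
  fix c assume c: "c \<in> A"
  obtain U \<phi> where c_eq: "c = (U, \<phi>)" by (cases c)
  have chart: "is_chart M (U, \<phi>)"
    using atlas c by (simp add: smooth_atlas_def c_eq)
  show "openin M (fst c)" using is_chartD(1)[OF chart] by (simp add: c_eq)
  have "smooth_on (\<phi> ` U) (F \<circ> inv_into U \<phi>)"
    using F c by (auto simp: smooth_map_def c_eq)
  then have "continuous_map (top_of_set (\<phi> ` U)) euclidean (F \<circ> inv_into U \<phi>)"
    using smooth_on_imp_continuous_on by (simp only: continuous_map_iff_continuous)
  with is_chartD(4)[OF chart]
  have "continuous_map (subtopology M U) euclidean ((F \<circ> inv_into U \<phi>) \<circ> \<phi>)"
    by (rule continuous_map_compose)
  then show "continuous_map (subtopology M (fst c)) euclidean F"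
    unfolding c_eq fst_conv by (rule continuous_map_eq) (simp add: inv_into_f_f[OF is_chartD(3)[OF chart]])
next
  fix x assume "x \<in> topspace M"
  then show "\<exists>c. c \<in> A \<and> x \<in> fst c \<and> F x = F x"
    using atlas by (force simp: smooth_atlas_def)
qed simp

lemma compact_space_attains_max:
  fixes h :: "'a \<Rightarrow> real"
  assumes "compact_space M" "topspace M \<noteq> {}" "continuous_map M euclidean h"
  shows "\<exists>p\<in>topspace M. \<forall>q\<in>topspace M. h q \<le> h p"
proof -
  have "compact (h ` topspace M)"
    using image_compactin[OF _ assms(3)] assms(1) by (simp add: compact_space_def)
  from compact_attains_sup[OF this] assms(2) show ?thesis
    by blast
qed

lemma linear_zero_on_axes:
  fixes g :: "real^'n::finite \<Rightarrow> real"
  assumes "linear g" "\<And>i. g (axis i 1) = 0"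
  shows "g v = 0"
proof -
  have "g v = (\<Sum>i\<in>UNIV. v $ i * g (axis i 1))"
    by (subst basis_expansion[of v, symmetric])
      (simp add: linear_sum[OF assms(1)] linear_cmul[OF assms(1)] scalar_mult_eq_scaleR)
  then show ?thesis using assms(2) by simp
qed

text \<open>If a normal \<open>\<nu>\<close> of the image of \<open>D\<close> is not horizontal, the image contains no vertical vector:
  \<open>\<langle>\<nu>, (0, t)\<rangle> = t \<langle>\<nu>, e\<^sub>n\<^sub>+\<^sub>1\<rangle>\<close>. So the horizontal part of \<open>D\<close> is an injective endomorphism of \<open>\<real>\<^sup>n\<close>,
  hence surjective.\<close>

lemma nonvertical_tangent_space_projects_onto:
  fixes D :: "real^'n::finite \<Rightarrow> 'n ambient"
  assumes lin: "linear D" and inj: "inj D"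
    and normal: "\<And>v. \<nu> \<bullet> D v = 0" and \<nu>: "\<nu> \<bullet> e_last \<noteq> 0"
  shows "surj (\<lambda>v. fst (D v))"
proof (rule linear_inj_imp_surj)
  show linear_fst_D: "linear (\<lambda>v. fst (D v))"
    using linear_compose[OF lin linear_fst] by (simp add: o_def)
  show "inj (\<lambda>v. fst (D v))"
    unfolding linear_injective_0[OF linear_fst_D]
  proof (intro allI impI)
    fix v assume 0: "fst (D v) = 0"
    then have "snd (D v) = 0"
      using normal[of v] \<nu> by (auto simp: e_last_def inner_prod_def)
    with 0 have "D v = 0" by (simp add: prod_eq_iff)
    then show "v = 0" using inj linear_injective_0[OF lin] by blast
  qed
qed

text \<open>At a maximum of a horizontal coordinate \<open>h\<close> the differential of \<open>h\<close> vanishes, so the horizontal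
  parts of the tangent vectors have \<open>k\<close>-th entry \<open>0\<close> and do not fill \<open>\<real>\<^sup>n\<close>. By the preceding lemma the
  normal is horizontal there.\<close>

lemma unit_normal_horizontal_somewhere:
  fixes A :: "('a, 'n::finite) chart set"
  assumes closed: "closed_manifold M A"
    and imm: "immersion A F" and unf: "unit_normal_field A F \<nu>"
  obtains p where "p \<in> topspace M" "\<nu> p \<bullet> e_last = 0"
proof -
  fix k :: 'n
  have atlas: "smooth_atlas M A" and compact: "compact_space M" and ne: "topspace M \<noteq> {}"
    using closed by (auto simp: closed_manifold_def)
  have smooth: "smooth_map A F" using imm by (simp add: immersion_def)
  define h where "h = (\<lambda>p. fst (F p) $ k)"
  have "continuous_on UNIV (\<lambda>y::'n ambient. fst y $ k)"
    by (intro continuous_intros)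
  then have "continuous_map M euclidean ((\<lambda>y. fst y $ k) \<circ> F)"
    by (intro continuous_map_compose[OF smooth_map_imp_continuous_map[OF atlas smooth]])
      simp
  then have "continuous_map M euclidean h" by (simp add: h_def o_def)
  then obtain p where p: "p \<in> topspace M" and max: "\<And>q. q \<in> topspace M \<Longrightarrow> h q \<le> h p"
    using compact_space_attains_max[OF compact ne] by blast
  obtain U \<phi> where c: "(U, \<phi>) \<in> A" and pU: "p \<in> U"
    using p atlas by (auto simp: smooth_atlas_def)
  have chart: "is_chart M (U, \<phi>)" using atlas c by (auto simp: smooth_atlas_def)
  note U = is_chartD(1)[OF chart] and op = is_chartD(2)[OF chart] and inj = is_chartD(3)[OF chart]
  define f where "f = F \<circ> inv_into U \<phi>"
  define x where "x = \<phi> p"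
  define D where "D = frechet_derivative f (at x)"
  have x: "x \<in> \<phi> ` U" using pU by (simp add: x_def)
  have "smooth_on (\<phi> ` U) f" using smooth c by (auto simp: smooth_map_def f_def)
  then have "f differentiable (at x)" using x by (rule smooth_on_imp_differentiable)
  then have D: "(f has_derivative D) (at x)"
    by (simp add: D_def frechet_derivative_works)
  then have linD: "linear D" by (rule has_derivative_linear)
  have injD: "inj D" using imm c x by (auto simp: immersion_def D_def f_def)
  have normal: "\<nu> p \<bullet> D v = 0" for v
  proof (rule linear_zero_on_axes)
    show "linear (\<lambda>v. \<nu> p \<bullet> D v)"
      using linear_compose[OF linD bounded_linear.linear[OF bounded_linear_inner_right[of "\<nu> p"]]]
      by (simp add: o_def)
    show "\<nu> p \<bullet> D (axis i 1) = 0" for i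
      using unf c pU by (auto simp: unit_normal_field_def partial_deriv_def D_def f_def x_def)
  qed
  have der: "((\<lambda>y. fst (f y) $ k) has_derivative (\<lambda>v. fst (D v) $ k)) (at x)"
    by (intro bounded_linear.has_derivative[OF bounded_linear_vec_nth] has_derivative_fst D)
  have le: "fst (f y) $ k \<le> fst (f x) $ k" if "y \<in> \<phi> ` U" for y
  proof -
    have "inv_into U \<phi> y \<in> topspace M"
      using inv_into_into[OF that] openin_subset[OF U] by blast
    from max[OF this] show ?thesis
      by (simp add: h_def f_def x_def inv_into_f_f[OF inj pU])
  qed
  have zero: "(\<lambda>v. fst (D v) $ k) = (\<lambda>v. 0)"
    using le by (intro differential_zero_maxmin[OF x op der] disjI1 ballI)
  have "\<not> surj (\<lambda>v. fst (D v))"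
  proof
    assume "surj (\<lambda>v. fst (D v))"
    then obtain v where "fst (D v) = axis k 1" by (metis surjD)
    with fun_cong[OF zero, of v] show False by simp
  qed
  then have "\<nu> p \<bullet> e_last = 0"
    using nonvertical_tangent_space_projects_onto[OF linD injD normal] by blast
  with p show ?thesis by (rule that)
qed

theorem theorem1p2:
  fixes \<Gamma> :: "(real^'n::finite) set" and \<gamma> :: "real^'n \<Rightarrow> real"
  assumes "curvature_function \<Gamma> \<gamma>"
    and "\<Gamma> = {l. \<gamma> l > 0}"
  shows "\<not> (\<exists>(M :: 'a topology) (A :: ('a, 'n) chart set) F \<nu> l.
            closed_manifold M A \<and> translator \<gamma> M A F \<nu> l \<and> (\<forall>p\<in>topspace M. l p \<in> \<Gamma>))"
proof (intro notI, elim exE conjE)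
  fix M :: "'a topology" and A :: "('a, 'n) chart set" and F \<nu> l
  assume M: "closed_manifold M A" and T: "translator \<gamma> M A F \<nu> l"
    and l: "\<forall>p\<in>topspace M. l p \<in> \<Gamma>"
  have "immersion A F" "unit_normal_field A F \<nu>"
    using T by (auto simp: translator_def)
  from unit_normal_horizontal_somewhere[OF M this] obtain p
    where p: "p \<in> topspace M" "\<nu> p \<bullet> e_last = 0" .
  then have "\<gamma> (l p) = 0" using T by (auto simp: translator_def)
  moreover have "\<gamma> (l p) > 0" using assms(1) l p(1) by (auto simp: curvature_function_def)
  ultimately show False by simp
qed

end
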